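(* Let $L$ be a pairwise similar lobster (with spine $(v_1,\ldots,v_r)$) in which every spinal vertex is essentially odd. Then $L$ is graceful.
   Context: A graph $G=(V,E)$ with $m$ edges is graceful if there is an injective $f:V\to\{0,\ldots,m\}$ with the edge labels $|f(u)-f(v)|$, $uv\in E$, pairwise distinct. A lobster is a tree whose base (the tree obtained by deleting all degree-one vertices) is a caterpillar, a caterpillar being a tree whose base is a path. A lobster $L$ is described by a spine, a path $(v_1,\ldots,v_r)$ of spinal vertices, together with, for each $i$, a tree $F_i$ (the lobe at $v_i$), the lobes being pairwise vertex-disjoint and each meeting the spine only in $v_i$, with $L$ the union of the spine and the lobes; each lobe $F_i$ consists of $v_i$, vertices $u_{i1},\ldots,u_{is_i}$ ($s_i\ge0$) adjacent to $v_i$, and for each $j$ some $k_{ij}\ge 0$ further vertices adjacent only to $u_{ij}$. The star formed by $u_{ij}$ and its $k_{ij}$ other neighbours is a branch at $v_i$; if $k_{ij}=0$, $u_{ij}$ is a pendant vertex at $v_i$. The reduced lobe $F'_i$ is $F_i$ with all pendant vertices at $v_i$ deleted. $L$ is pairwise similar if $F'_i\cong F'_{i+1}$ for all odd $i\in\{1,\ldots,r-1\}$. A spinal vertex $v_i$ is essentially odd if its degree in $F'_i$ is odd, and essentially even if its degree in $F'_i$ is even and non-zero. *)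

theory Defs
  imports Main
begin

definition simple_graph :: "'a set \<Rightarrow> 'a set set \<Rightarrow> bool" where
  "simple_graph V E \<longleftrightarrow> finite V \<and> (\<forall>e\<in>E. e \<subseteq> V \<and> card e = 2)"

definition degree :: "'a set set \<Rightarrow> 'a \<Rightarrow> nat" where
  "degree E x = card {e\<in>E. x \<in> e}"

definition graph_iso :: "'a set \<Rightarrow> 'a set set \<Rightarrow> 'b set \<Rightarrow> 'b set set \<Rightarrow> bool" where
  "graph_iso V E W F \<longleftrightarrow>
     (\<exists>\<phi>. bij_betw \<phi> V W \<and> (\<forall>x\<in>V. \<forall>y\<in>V. ({x, y} \<in> E \<longleftrightarrow> {\<phi> x, \<phi> y} \<in> F)))"

definition graceful :: "'a set \<Rightarrow> 'a set set \<Rightarrow> bool" where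
  "graceful V E \<longleftrightarrow>
     (\<exists>f :: 'a \<Rightarrow> int. inj_on f V \<and> f ` V \<subseteq> {0 .. int (card E)} \<and>
        (\<forall>u v x y. {u, v} \<in> E \<longrightarrow> {x, y} \<in> E \<longrightarrow>
            \<bar>f u - f v\<bar> = \<bar>f x - f y\<bar> \<longrightarrow> {u, v} = {x, y}))"

text \<open>Vertices: spinal vertex v_i = Sp i (1 \<le> i \<le> r); u_ij = Br i j (1 \<le> j \<le> s i);
  the further neighbours of u_ij are Lf i j l (1 \<le> l \<le> k i j).\<close>

datatype lob_vertex = Sp nat | Br nat nat | Lf nat nat nat

definition lobster_verts :: "nat \<Rightarrow> (nat \<Rightarrow> nat) \<Rightarrow> (nat \<Rightarrow> nat \<Rightarrow> nat) \<Rightarrow> lob_vertex set" where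
  "lobster_verts r s k =
     {Sp i | i. 1 \<le> i \<and> i \<le> r}
     \<union> {Br i j | i j. 1 \<le> i \<and> i \<le> r \<and> 1 \<le> j \<and> j \<le> s i}
     \<union> {Lf i j l | i j l. 1 \<le> i \<and> i \<le> r \<and> 1 \<le> j \<and> j \<le> s i \<and> 1 \<le> l \<and> l \<le> k i j}"

definition lobster_edges :: "nat \<Rightarrow> (nat \<Rightarrow> nat) \<Rightarrow> (nat \<Rightarrow> nat \<Rightarrow> nat) \<Rightarrow> lob_vertex set set" where
  "lobster_edges r s k =
     {{Sp i, Sp (Suc i)} | i. 1 \<le> i \<and> i < r}
     \<union> {{Sp i, Br i j} | i j. 1 \<le> i \<and> i \<le> r \<and> 1 \<le> j \<and> j \<le> s i}
     \<union> {{Br i j, Lf i j l} | i j l. 1 \<le> i \<and> i \<le> r \<and> 1 \<le> j \<and> j \<le> s i \<and> 1 \<le> l \<and> l \<le> k i j}"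

text \<open>Reduced lobe F'_i: the lobe F_i at v_i with the pendant vertices at v_i
  (those u_ij with k_ij = 0) deleted.\<close>

definition reduced_lobe_verts :: "(nat \<Rightarrow> nat) \<Rightarrow> (nat \<Rightarrow> nat \<Rightarrow> nat) \<Rightarrow> nat \<Rightarrow> lob_vertex set" where
  "reduced_lobe_verts s k i =
     {Sp i}
     \<union> {Br i j | j. 1 \<le> j \<and> j \<le> s i \<and> k i j \<noteq> 0}
     \<union> {Lf i j l | j l. 1 \<le> j \<and> j \<le> s i \<and> k i j \<noteq> 0 \<and> 1 \<le> l \<and> l \<le> k i j}"

definition reduced_lobe_edges :: "(nat \<Rightarrow> nat) \<Rightarrow> (nat \<Rightarrow> nat \<Rightarrow> nat) \<Rightarrow> nat \<Rightarrow> lob_vertex set set" where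
  "reduced_lobe_edges s k i =
     {{Sp i, Br i j} | j. 1 \<le> j \<and> j \<le> s i \<and> k i j \<noteq> 0}
     \<union> {{Br i j, Lf i j l} | j l. 1 \<le> j \<and> j \<le> s i \<and> k i j \<noteq> 0 \<and> 1 \<le> l \<and> l \<le> k i j}"

definition pairwise_similar :: "nat \<Rightarrow> (nat \<Rightarrow> nat) \<Rightarrow> (nat \<Rightarrow> nat \<Rightarrow> nat) \<Rightarrow> bool" where
  "pairwise_similar r s k \<longleftrightarrow>
     (\<forall>i. odd i \<and> 1 \<le> i \<and> i \<le> r - 1 \<longrightarrow>
        graph_iso (reduced_lobe_verts s k i) (reduced_lobe_edges s k i)
                  (reduced_lobe_verts s k (Suc i)) (reduced_lobe_edges s k (Suc i)))"

definition essentially_odd :: "(nat \<Rightarrow> nat) \<Rightarrow> (nat \<Rightarrow> nat \<Rightarrow> nat) \<Rightarrow> nat \<Rightarrow> bool" where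
  "essentially_odd s k i \<longleftrightarrow> odd (degree (reduced_lobe_edges s k i) (Sp i))"

end

theory Submission
  imports Defs
begin

text \<open>
  Only labellings with the first spinal vertex labelled 0 are considered. If T is a bipartite tree
  on n vertices with such a labelling f, and Q is a tree on q vertices rooted at w and labelled in
  the same way, then with D = n + q - 1 one copy of T gets f on the colour class of the root and
  f + D on the other class, a second copy gets these the other way round, and Q gets D - f. The two
  copies of an edge labelled d receive D - d and D + d, the edge joining the two roots receives D,
  and Q keeps its edge labels, all below q. Thus two isomorphic reduced lobes can be wrapped around the
  rest of the lobster, and pendant vertices at the root receive new largest labels. It remains to
  label a single reduced lobe with centre 0. Its odd number of branch vertices receive
  m, 1, m - 1, 2, ..., and the leaves, at first all attached to m, are transferred along this
  sequence: first the branches with an odd number of leaves are served, then those with an even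
  number.
\<close>

section \<open>Leaf transfers\<close>

text \<open>
  The centres of the transfer are W, W', W - 1, W' + 1, ..., and \<open>transfer_label W W' t x\<close> is the
  difference of the t-th centre and x, signed so that it is positive when all leaf labels x lie
  between W' and W. In \<open>distributes\<close>, g x is the centre to which leaf x is attached; the last
  condition says that the edge labels are those obtained by attaching all leaves to W.
\<close>

definition transfer_label :: "int \<Rightarrow> int \<Rightarrow> nat \<Rightarrow> int \<Rightarrow> int" where
  "transfer_label W W' t x =
     (if even t then W - int (t div 2) - x else x - W' - int (t div 2))"

definition distributes :: "int \<Rightarrow> int \<Rightarrow> nat list \<Rightarrow> int set \<Rightarrow> bool" where
  "distributes W W' ks X \<longleftrightarrow>
     (\<exists>g. (\<forall>x\<in>X. g x < length ks) \<and>
          (\<forall>t<length ks. card {x\<in>X. g x = t} = ks ! t) \<and>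
          (\<lambda>x. transfer_label W W' (g x) x) ` X = (\<lambda>x. W - x) ` X)"

lemma transfer_label_0: "transfer_label W W' 0 x = W - x"
  by (simp add: transfer_label_def)

text \<open>Dropping the first centre leaves W', W - 1, W' + 1, ...; negated, this is -W', 1 - W,
  -W' - 1, ..., again a sequence of transfer centres.\<close>

lemma transfer_label_Suc:
  "transfer_label W W' (Suc t) x = transfer_label (- W') (1 - W) t (- x)"
  by (cases "even t") (auto simp: transfer_label_def)

lemma distributes_Nil: "distributes W W' [] {}"
  by (simp add: distributes_def)

text \<open>
  A set of leaves that is symmetric under x to W + W' - x can be moved from W to W' without changing
  the set of edge labels; negating all labels then makes W' the upper centre.
\<close>

lemma distributes_Cons:
  assumes "distributes (- W') (1 - W) ks (uminus ` X)"
    and sym: "(\<lambda>x. W + W' - x) ` X = X"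
    and disj: "K \<inter> X = {}" and card: "card K = k"
  shows "distributes W W' (k # ks) (K \<union> X)"
proof -
  obtain g where g: "\<forall>x\<in>uminus ` X. g x < length ks"
      "\<forall>t<length ks. card {x\<in>uminus ` X. g x = t} = ks ! t"
      "(\<lambda>x. transfer_label (- W') (1 - W) (g x) x) ` uminus ` X = (\<lambda>x. - W' - x) ` uminus ` X"
    using assms(1) unfolding distributes_def by (elim exE conjE) (rule that)
  define h where "h x = (if x \<in> X then Suc (g (- x)) else 0)" for x
  have "card {x \<in> K \<union> X. h x = t} = (k # ks) ! t" if "t < length (k # ks)" for t
  proof (cases t)
    case 0
    have "{x \<in> K \<union> X. h x = t} = K" using disj by (auto simp: h_def 0)
    then show ?thesis using card by (simp add: 0)
  next
    case (Suc u)
    have "{x \<in> K \<union> X. h x = t} = {x \<in> X. g (- x) = u}"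
      by (auto simp: h_def Suc)
    then have "uminus ` {x \<in> K \<union> X. h x = t} = {x\<in>uminus ` X. g x = u}"
      by auto
    moreover have "card (uminus ` {x \<in> K \<union> X. h x = t}) = card {x \<in> K \<union> X. h x = t}"
      by (rule card_image) simp
    ultimately show ?thesis using g(2) that Suc by simp
  qed
  moreover have "(\<lambda>x. transfer_label W W' (h x) x) ` (K \<union> X) = (\<lambda>x. W - x) ` (K \<union> X)"
  proof -
    have "(\<lambda>x. transfer_label W W' (h x) x) ` K = (\<lambda>x. W - x) ` K"
      using disj by (intro image_cong) (auto simp: h_def transfer_label_0)
    moreover have "(\<lambda>x. transfer_label W W' (h x) x) ` X
        = (\<lambda>x. transfer_label (- W') (1 - W) (g x) x) ` uminus ` X"
      unfolding image_image by (intro image_cong) (auto simp: h_def transfer_label_Suc)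
    \<comment> \<open>A leaf x attached to W' has label x - W' = W - (W + W' - x), the label at W of
      its mirror image, which by symmetry lies in \<open>X\<close> again.\<close>
    moreover have "(\<lambda>x. - W' - x) ` uminus ` X = (\<lambda>x. W - x) ` (\<lambda>x. W + W' - x) ` X"
      unfolding image_image by (intro image_cong) auto
    ultimately show ?thesis using g(3) sym by (simp only: image_Un)
  qed
  moreover have "\<forall>x\<in>K \<union> X. h x < length (k # ks)" using g(1) by (auto simp: h_def)
  ultimately show ?thesis unfolding distributes_def by (intro exI[of _ h]) simp
qed

lemma reflect_interval: "(\<lambda>x. c - x) ` {a..<b} = {c - b + 1..<c - a + (1::int)}"
proof
  show "{c - b + 1..<c - a + 1} \<subseteq> (\<lambda>x. c - x) ` {a..<b}"
  proof
    fix y assume "y \<in> {c - b + 1..<c - a + 1}"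
    then have "c - y \<in> {a..<b}" "y = c - (c - y)" by auto
    then show "y \<in> (\<lambda>x. c - x) ` {a..<b}" by blast
  qed
qed auto

lemma uminus_interval: "uminus ` {a..<b} = {1 - b..<1 - (a::int)}"
  by (auto simp: image_iff intro: bexI[of _ "- _"])

text \<open>The two blocks are mirror images under x -> W + W' - 1 - x, one off from the reflection
  that a transfer needs. Keeping the first label \<open>c\<close> of the upper block, together with
  outer ends of both blocks, corrects this. The gap between the blocks then grows by one, which is
  why the induction speaks of two blocks and not of an interval.\<close>

lemma distributes_even:
  assumes "\<forall>k\<in>set ks. even k \<and> 0 < k" "sum_list ks = 2 * l"
    and "a + c + int l = W + W'" "a + int l \<le> c"
  shows "distributes W W' ks ({a..<a + int l} \<union> {c..<c + int l})"
  using assms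
proof (induction ks arbitrary: W W' a c l)
  case Nil
  then show ?case by (simp add: distributes_Nil)
next
  case (Cons k ks)
  obtain p where "k = 2 * p" "p > 0" using Cons.prems(1) by (auto elim!: evenE)
  \<comment> \<open>Besides \<open>c\<close>, the first q + 1 labels of the lower block and the last
    q of the upper one are kept; having \<open>c\<close> available for this uses that
    \<open>k\<close> is positive.\<close>
  then obtain q where q: "k = 2 * q + 2" by (cases p) auto
  have even: "even (sum_list ks)" using Cons.prems(1) by (induction ks) auto
  then obtain l' where l': "sum_list ks = 2 * l'" by (auto elim: evenE)
  have l: "l = l' + q + 1" using l' Cons.prems(2) q by simp
  let ?K = "{a..a + int q} \<union> {c} \<union> {c + int l - int q..<c + int l}"
  let ?X = "{a + int q + 1..<a + int l} \<union> {c + 1..<c + int l - int q}"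
  have "distributes (- W') (1 - W) ks
      ({- (c + int l - 1 - int q)..<- (c + int l - 1 - int q) + int l'}
       \<union> {- (a + int l - 1)..<- (a + int l - 1) + int l'})"
    by (rule Cons.IH) (use Cons.prems l l' in auto)
  also have "{- (c + int l - 1 - int q)..<- (c + int l - 1 - int q) + int l'}
       \<union> {- (a + int l - 1)..<- (a + int l - 1) + int l'} = uminus ` ?X"
    unfolding image_Un uminus_interval l by auto
  finally have 1: "distributes (- W') (1 - W) ks (uminus ` ?X)" .
  have 2: "(\<lambda>x. W + W' - x) ` ?X = ?X"
    unfolding image_Un reflect_interval Cons.prems(3)[symmetric] l by auto
  have 3: "?K \<inter> ?X = {}" using Cons.prems(4) l by auto
  have 4: "card ?K = k"
  proof -
    have "card ?K = card ({a..a + int q} \<union> {c}) + card {c + int l - int q..<c + int l}"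
      by (rule card_Un_disjoint) (use Cons.prems(4) l in auto)
    also have "card ({a..a + int q} \<union> {c}) = card {a..a + int q} + card {c}"
      by (rule card_Un_disjoint) (use Cons.prems(4) l in auto)
    finally show ?thesis by (simp add: q)
  qed
  have "?K \<union> ?X = {a..<a + int l} \<union> {c..<c + int l}" using l by auto
  with distributes_Cons[OF 1 2 3 4] show ?case by simp
qed

text \<open>Keeping q + 1 labels at the lower end and q at the upper end leaves an interval with the
  symmetry that a transfer needs, so an odd count reproduces the same situation. An even count
  breaks the interval into two blocks, so the even counts come last.\<close>

lemma distributes_interval:
  assumes "\<forall>k\<in>set os. odd k" "\<forall>k\<in>set es. even k \<and> 0 < k"
    and "a + int (sum_list (os @ es)) = b" "a + b = W + W'"
  shows "distributes W W' (os @ es) {a..<b}"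
  using assms
proof (induction os arbitrary: W W' a b)
  case Nil
  have "even (sum_list es)" using Nil.prems(2) by (induction es) auto
  then obtain l where l: "sum_list es = 2 * l" by (auto elim: evenE)
  \<comment> \<open>The two blocks start as the halves of the interval, with no gap between
    them.\<close>
  have "distributes W W' es ({a..<a + int l} \<union> {a + int l..<(a + int l) + int l})"
    by (rule distributes_even) (use Nil.prems l in auto)
  also have "{a..<a + int l} \<union> {a + int l..<(a + int l) + int l} = {a..<b}"
    using Nil.prems l by auto
  finally show ?case by simp
next
  case (Cons k os)
  obtain q where q: "k = 2 * q + 1" using Cons.prems(1) by (auto elim: oddE)
  let ?K = "{a..a + int q} \<union> {b - int q..<b}"
  let ?X = "{a + int q + 1..<b - int q}"
  have b: "b = a + 2 * int q + 1 + int (sum_list (os @ es))"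
    using Cons.prems(3) q by simp
  have "distributes (- W') (1 - W) (os @ es) {1 - (b - int q)..<1 - (a + int q + 1)}"
    by (rule Cons.IH) (use Cons.prems b in auto)
  then have 1: "distributes (- W') (1 - W) (os @ es) (uminus ` ?X)"
    by (simp only: uminus_interval)
  have 2: "(\<lambda>x. W + W' - x) ` ?X = ?X"
    unfolding reflect_interval Cons.prems(4)[symmetric] by auto
  have 3: "?K \<inter> ?X = {}" by auto
  have 4: "card ?K = k"
  proof -
    have "card ?K = card {a..a + int q} + card {b - int q..<b}"
      by (rule card_Un_disjoint) (use b in auto)
    then show ?thesis by (simp add: q)
  qed
  have "?K \<union> ?X = {a..<b}" using b by auto
  with distributes_Cons[OF 1 2 3 4] show ?case by simp
qed

section \<open>Graceful labellings with root labelled zero\<close>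

text \<open>
  Injectivity of the vertex and edge labels is not demanded: it follows from surjectivity onto
  intervals of size N and N - 1 together with the bounds on the cardinalities.
\<close>

definition rooted_graceful :: "'a set \<Rightarrow> 'a set set \<Rightarrow> 'a \<Rightarrow> bool" where
  "rooted_graceful V E v \<longleftrightarrow> simple_graph V E \<and> v \<in> V \<and>
     (\<exists>(f :: 'a \<Rightarrow> int) N. card V \<le> N \<and> card E < N \<and> f v = 0 \<and>
        (\<forall>y. 0 \<le> y \<and> y < int N \<longrightarrow> y \<in> f ` V) \<and>
        (\<forall>d. 1 \<le> d \<and> d < int N \<longrightarrow> (\<exists>x y. {x, y} \<in> E \<and> \<bar>f x - f y\<bar> = d)))"

lemma simple_graph_finite_edges: "simple_graph V E \<Longrightarrow> finite E"
  unfolding simple_graph_def by (rule finite_subset[of _ "Pow V"]) auto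

lemma simple_graphD: "simple_graph V E \<Longrightarrow> {x, y} \<in> E \<Longrightarrow> x \<in> V \<and> y \<in> V \<and> x \<noteq> y"
  unfolding simple_graph_def by (auto dest!: bspec[of E _ "{x, y}"] simp: card_insert_if split: if_splits)

lemma simple_graph_edgeE:
  assumes "simple_graph V E" "e \<in> E"
  obtains x y where "e = {x, y}" "x \<in> V" "y \<in> V" "x \<noteq> y"
  using assms unfolding simple_graph_def by (metis card_2_iff insert_subset)

lemma rooted_gracefulE:
  assumes "rooted_graceful V E v"
  obtains f :: "'a \<Rightarrow> int" and N where "simple_graph V E" "v \<in> V" "finite V" "finite E"
    "card V \<le> N" "card E < N" "f v = 0"
    "\<And>y. 0 \<le> y \<Longrightarrow> y < int N \<Longrightarrow> \<exists>x\<in>V. f x = y"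
    "\<And>d. 1 \<le> d \<Longrightarrow> d < int N \<Longrightarrow> \<exists>x y. {x, y} \<in> E \<and> \<bar>f x - f y\<bar> = d"
proof -
  obtain f :: "'a \<Rightarrow> int" and N where f: "simple_graph V E" "v \<in> V"
    "card V \<le> N" "card E < N" "f v = 0"
    "\<forall>y. 0 \<le> y \<and> y < int N \<longrightarrow> y \<in> f ` V"
    "\<forall>d. 1 \<le> d \<and> d < int N \<longrightarrow> (\<exists>x y. {x, y} \<in> E \<and> \<bar>f x - f y\<bar> = d)"
    using assms unfolding rooted_graceful_def by blast
  show thesis
  proof (rule that)
    show "finite V" using f(1) by (simp add: simple_graph_def)
    show "\<exists>x\<in>V. f x = y" if "0 \<le> y" "y < int N" for y using f(6) that by blast
  qed (use f simple_graph_finite_edges in blast)+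
qed

lemma rooted_gracefulI:
  fixes f :: "'a \<Rightarrow> int"
  assumes "simple_graph V E" "v \<in> V" "card V \<le> N" "card E < N" "f v = 0"
    "\<And>y. 0 \<le> y \<Longrightarrow> y < int N \<Longrightarrow> \<exists>x\<in>V. f x = y"
    "\<And>d. 1 \<le> d \<Longrightarrow> d < int N \<Longrightarrow> \<exists>x y. {x, y} \<in> E \<and> \<bar>f x - f y\<bar> = d"
  shows "rooted_graceful V E v"
proof -
  have "\<forall>y. 0 \<le> y \<and> y < int N \<longrightarrow> y \<in> f ` V" using assms(6) by blast
  then show ?thesis using assms unfolding rooted_graceful_def by blast
qed

lemma rooted_graceful_single: "rooted_graceful {v} {} v"
  by (rule rooted_gracefulI[where f = "\<lambda>_. 0" and N = 1]) (auto simp: simple_graph_def)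

section \<open>Enlarging a labelled tree at its root\<close>

lemma rooted_graceful_pendant:
  assumes "rooted_graceful V E v" "p \<notin> V"
  shows "rooted_graceful (insert p V) (insert {v, p} E) v"
proof -
  obtain f N where f: "simple_graph V E" "v \<in> V" "finite V" "finite E"
    "card V \<le> N" "card E < N" "f v = 0"
    "\<And>y. 0 \<le> y \<Longrightarrow> y < int N \<Longrightarrow> \<exists>x\<in>V. f x = y"
    "\<And>d. 1 \<le> d \<Longrightarrow> d < int N \<Longrightarrow> \<exists>x y. {x, y} \<in> E \<and> \<bar>f x - f y\<bar> = d"
    using rooted_gracefulE[OF assms(1)] by metis
  let ?f = "f(p := int N)"
  have vp: "v \<noteq> p" using f(2) assms(2) by auto
  show ?thesis
  proof (rule rooted_gracefulI[where f = ?f and N = "Suc N"])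
    show "simple_graph (insert p V) (insert {v, p} E)"
      using f(1,2) assms(2) vp unfolding simple_graph_def by auto
    show "card (insert p V) \<le> Suc N" "card (insert {v, p} E) < Suc N"
      using f(3-6) by (auto simp: card_insert_if)
    show "\<exists>x\<in>insert p V. ?f x = y" if y: "0 \<le> y" "y < int (Suc N)" for y
    proof (cases "y = int N")
      case False
      then obtain x where "x \<in> V" "f x = y" using f(8)[of y] y by auto
      then show ?thesis using assms(2) by auto
    qed auto
    show "\<exists>x y. {x, y} \<in> insert {v, p} E \<and> \<bar>?f x - ?f y\<bar> = d" if d: "1 \<le> d" "d < int (Suc N)" for d
    proof (cases "d = int N")
      case True
      then show ?thesis using vp f(7) by (intro exI[of _ v] exI[of _ p]) auto
    next
      case False
      then obtain x y where xy: "{x, y} \<in> E" "\<bar>f x - f y\<bar> = d" using f(9)[of d] d by auto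
      then have "x \<noteq> p" "y \<noteq> p" using simple_graphD[OF f(1)] assms(2) by blast+
      then show ?thesis using xy by (intro exI[of _ x] exI[of _ y]) auto
    qed
  qed (use f(2,7) vp in auto)
qed

lemma rooted_graceful_pendants:
  assumes "rooted_graceful V E v" "finite P" "P \<inter> V = {}"
  shows "rooted_graceful (V \<union> P) (E \<union> (\<lambda>p. {v, p}) ` P) v"
  using assms(2,3)
proof (induction P)
  case empty
  then show ?case using assms(1) by simp
next
  case (insert p P)
  then show ?case using rooted_graceful_pendant[of "V \<union> P" "E \<union> (\<lambda>p. {v, p}) ` P" v p] by simp
qed

text \<open>Complementing the labels to N - f keeps all edge labels, frees 0 for the new root and
  moves the old root to N, which becomes the label of the new edge.\<close>

lemma rooted_graceful_new_root:
  assumes "rooted_graceful V E w" "v \<notin> V"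
  shows "rooted_graceful (insert v V) (insert {v, w} E) v"
proof -
  obtain f N where f: "simple_graph V E" "w \<in> V" "finite V" "finite E"
    "card V \<le> N" "card E < N" "f w = 0"
    "\<And>y. 0 \<le> y \<Longrightarrow> y < int N \<Longrightarrow> \<exists>x\<in>V. f x = y"
    "\<And>d. 1 \<le> d \<Longrightarrow> d < int N \<Longrightarrow> \<exists>x y. {x, y} \<in> E \<and> \<bar>f x - f y\<bar> = d"
    using rooted_gracefulE[OF assms(1)] by metis
  let ?f = "(\<lambda>x. int N - f x)(v := 0)"
  have vw: "w \<noteq> v" using f(2) assms(2) by auto
  show ?thesis
  proof (rule rooted_gracefulI[where f = ?f and N = "Suc N"])
    show "simple_graph (insert v V) (insert {v, w} E)"
      using f(1,2) assms(2) vw unfolding simple_graph_def by auto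
    show "card (insert v V) \<le> Suc N" "card (insert {v, w} E) < Suc N"
      using f(3-6) by (auto simp: card_insert_if)
    show "\<exists>x\<in>insert v V. ?f x = y" if y: "0 \<le> y" "y < int (Suc N)" for y
    proof (cases "y = 0")
      case False
      then obtain x where "x \<in> V" "f x = int N - y" using f(8)[of "int N - y"] y by auto
      then show ?thesis using assms(2) by auto
    qed auto
    show "\<exists>x y. {x, y} \<in> insert {v, w} E \<and> \<bar>?f x - ?f y\<bar> = d" if d: "1 \<le> d" "d < int (Suc N)" for d
    proof (cases "d = int N")
      case True
      then show ?thesis using vw f(7) by (intro exI[of _ v] exI[of _ w]) auto
    next
      case False
      then obtain x y where xy: "{x, y} \<in> E" "\<bar>f x - f y\<bar> = d" using f(9)[of d] d by auto
      then have "x \<noteq> v" "y \<noteq> v" using simple_graphD[OF f(1)] assms(2) by blast+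
      then show ?thesis using xy by (intro exI[of _ x] exI[of _ y]) auto
    qed
  qed auto
qed

text \<open>With D = n + q - 1 the ranges fit exactly. Vertex labels 0, ..., n - 1 and D, ..., D + n
  - 1 come from the two copies of \<open>T\<close>, and n, ..., D from \<open>Q\<close>. Edge labels
  1, ..., q - 1 come from \<open>Q\<close>, D from the new edge, and all others up to D + n - 1 from
  the copies. The colouring ensures that exactly one end of each edge in a copy is shifted by
  D.\<close>

lemma rooted_graceful_double:
  assumes T: "rooted_graceful T F v" and Q: "rooted_graceful Q E w"
    and col: "\<And>x y. {x, y} \<in> F \<Longrightarrow> col x \<longleftrightarrow> \<not> col y" and colv: "col v"
    and inj: "inj_on \<phi> T" and w: "\<phi> v = w"
    and disj: "T \<inter> \<phi> ` T = {}" "T \<inter> Q = {}" "\<phi> ` T \<inter> Q = {w}"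
  shows "rooted_graceful (T \<union> \<phi> ` T \<union> Q) (F \<union> (`) \<phi> ` F \<union> E \<union> {{v, w}}) v"
proof -
  obtain f n where f: "simple_graph T F" "v \<in> T" "finite T" "finite F"
    "card T \<le> n" "card F < n" "f v = 0"
    "\<And>y. 0 \<le> y \<Longrightarrow> y < int n \<Longrightarrow> \<exists>x\<in>T. f x = y"
    "\<And>d. 1 \<le> d \<Longrightarrow> d < int n \<Longrightarrow> \<exists>x y. {x, y} \<in> F \<and> \<bar>f x - f y\<bar> = d"
    using rooted_gracefulE[OF T] by metis
  obtain g q where g: "simple_graph Q E" "w \<in> Q" "finite Q" "finite E"
    "card Q \<le> q" "card E < q" "g w = 0"
    "\<And>y. 0 \<le> y \<Longrightarrow> y < int q \<Longrightarrow> \<exists>x\<in>Q. g x = y"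
    "\<And>d. 1 \<le> d \<Longrightarrow> d < int q \<Longrightarrow> \<exists>x y. {x, y} \<in> E \<and> \<bar>g x - g y\<bar> = d"
    using rooted_gracefulE[OF Q] by metis
  define D where "D = int n + int q - 1"
  define \<psi> where "\<psi> = inv_into T \<phi>"
  have \<psi>: "\<psi> (\<phi> x) = x" if "x \<in> T" for x
    using inj that by (simp add: \<psi>_def)
  define h where "h x = (if x \<in> T then if col x then f x else f x + D
     else if x \<in> \<phi> ` T then if col (\<psi> x) then f (\<psi> x) + D else f (\<psi> x)
     else D - g x)" for x
  have hT: "h x = (if col x then f x else f x + D)" if "x \<in> T" for x
    using that by (simp add: h_def)
  have hT': "h (\<phi> x) = (if col x then f x + D else f x)" if "x \<in> T" for x
    using that disj(1) by (auto simp: h_def \<psi>)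
  \<comment> \<open>The shared vertex \<open>w\<close> is labelled as a vertex of the second copy;
    its label f v + D = D agrees with D - g w.\<close>
  have hQ: "h x = D - g x" if "x \<in> Q" for x
  proof (cases "x = w")
    case True
    then show ?thesis using hT'[OF f(2)] colv f(7) g(7) w by simp
  next
    case False
    then show ?thesis using that disj unfolding h_def by auto
  qed
  have q: "q \<ge> 1" and n: "n \<ge> 1" using f(6) g(6) by auto
  show ?thesis
  proof (rule rooted_gracefulI[where f = h and N = "2 * n + q - 1"])
    have wT: "w \<in> \<phi> ` T" using f(2) w by auto
    then have vw: "v \<noteq> w" using f(2) disj(1) by auto
    have "\<phi> ` e \<subseteq> \<phi> ` T \<and> card (\<phi> ` e) = 2" if "e \<in> F" for e
      using that f(1) inj unfolding simple_graph_def
      by (metis card_image image_mono inj_on_subset)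
    then show "simple_graph (T \<union> \<phi> ` T \<union> Q) (F \<union> (`) \<phi> ` F \<union> E \<union> {{v, w}})"
      using f(1,2) g(1,2) vw unfolding simple_graph_def by auto
    \<comment> \<open>The vertex \<open>w\<close> lies in the second copy and in \<open>Q\<close>;
      counting it once gives the -1 in the bound.\<close>
    have "card (T \<union> \<phi> ` T \<union> Q) = card (T \<union> \<phi> ` T \<union> (Q - {w}))"
      using wT by (intro arg_cong[where f = card]) auto
    also have "\<dots> \<le> card T + card (\<phi> ` T) + card (Q - {w})"
      by (meson add_le_mono1 card_Un_le le_trans)
    also have "\<dots> \<le> 2 * n + q - 1"
      using f(3,5) g(2,3,5) card_image_le[OF f(3), of \<phi>] q by simp
    finally show "card (T \<union> \<phi> ` T \<union> Q) \<le> 2 * n + q - 1" .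
    have "card (F \<union> (`) \<phi> ` F \<union> E \<union> {{v, w}}) \<le> card F + card ((`) \<phi> ` F) + card E + card {{v, w}}"
      by (meson add_le_mono1 card_Un_le le_trans)
    also have "\<dots> < 2 * n + q - 1"
      using f(6) g(6) card_image_le[OF f(4), of "(`) \<phi>"] by simp
    finally show "card (F \<union> (`) \<phi> ` F \<union> E \<union> {{v, w}}) < 2 * n + q - 1" .
    show "h v = 0" using hT[OF f(2)] colv f(7) by simp
    show "\<exists>x\<in>T \<union> \<phi> ` T \<union> Q. h x = y" if y: "0 \<le> y" "y < int (2 * n + q - 1)" for y
    proof -
      consider "y < int n" | "int n \<le> y" "y < D" | "D \<le> y" by linarith
      then show ?thesis
      proof cases
        case 1
        then obtain x where "x \<in> T" "f x = y" using f(8) y by blast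
        then show ?thesis using hT[of x] hT'[of x] by (cases "col x") auto
      next
        case 2
        then obtain x where "x \<in> Q" "g x = D - y" using g(8)[of "D - y"] D_def by auto
        then show ?thesis using hQ[of x] by auto
      next
        case 3
        then obtain x where "x \<in> T" "f x = y - D" using f(8)[of "y - D"] y D_def n q by auto
        then show ?thesis using hT[of x] hT'[of x] by (cases "col x") auto
      qed
    qed
    show "\<exists>x y. {x, y} \<in> F \<union> (`) \<phi> ` F \<union> E \<union> {{v, w}} \<and> \<bar>h x - h y\<bar> = d"
      if d: "1 \<le> d" "d < int (2 * n + q - 1)" for d
    proof -
      consider "d < int q" | "d = D" | "int q \<le> d" "d \<noteq> D" by linarith
      then show ?thesis
      proof cases
        case 1
        then obtain x y where xy: "{x, y} \<in> E" "\<bar>g x - g y\<bar> = d" using g(9) d by blast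
        then have "x \<in> Q" "y \<in> Q" using simple_graphD[OF g(1)] by blast+
        then have "\<bar>h x - h y\<bar> = d" using xy(2) hQ by auto
        then show ?thesis using xy(1) by blast
      next
        case 2
        have "h w = D" using hQ[OF g(2)] g(7) by simp
        then have "\<bar>h v - h w\<bar> = d" using \<open>h v = 0\<close> 2 d by simp
        then show ?thesis by blast
      next
        case 3
        \<comment> \<open>The labels still missing have distance 1, ..., n - 1 from D. An edge of
          \<open>F\<close> with label c yields D - c in one copy and D + c in the other.\<close>
        define c where "c = \<bar>d - D\<bar>"
        have "1 \<le> c" "c < int n" using 3 d D_def n q unfolding c_def by auto
        then obtain x y where xy0: "{x, y} \<in> F" "\<bar>f x - f y\<bar> = c" using f(9) by blast
        \<comment> \<open>With \<open>x\<close> in the colour class of the root, the first copy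
          shifts \<open>y\<close> and the second shifts \<open>x\<close>; the sign of f y - f x then
          decides which copy carries the label d.\<close>
        obtain x y where xy: "{x, y} \<in> F" "\<bar>f x - f y\<bar> = c" "col x" "\<not> col y"
        proof (cases "col x")
          case True
          then show ?thesis using that[OF xy0] col[OF xy0(1)] by blast
        next
          case False
          then show ?thesis using that[of y x] xy0 col[OF xy0(1)] by (simp add: insert_commute abs_minus_commute)
        qed
        have in_T: "x \<in> T" "y \<in> T" using simple_graphD[OF f(1)] xy(1) by blast+
        have D: "D \<ge> c" using \<open>c < int n\<close> q D_def by simp
        have a: "\<bar>h x - h y\<bar> = D + (f y - f x)" "\<bar>h (\<phi> x) - h (\<phi> y)\<bar> = D - (f y - f x)"
          using hT hT' in_T xy D by auto
        have "{\<phi> x, \<phi> y} \<in> (`) \<phi> ` F" using xy(1) by (metis image_empty image_eqI image_insert)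
        moreover have "\<bar>h x - h y\<bar> = d \<or> \<bar>h (\<phi> x) - h (\<phi> y)\<bar> = d"
          using a xy(2) unfolding c_def by linarith
        ultimately show ?thesis using xy(1) by blast
      qed
    qed
  qed (use f(2) in auto)
qed

section \<open>Transport along isomorphisms, and gracefulness\<close>

lemma rooted_graceful_graph_iso:
  assumes "graph_iso V E W F" "simple_graph V E" "rooted_graceful W F w"
  shows "\<exists>v. rooted_graceful V E v"
proof -
  obtain \<phi> where bij: "bij_betw \<phi> V W"
    and \<phi>: "\<And>x y. x \<in> V \<Longrightarrow> y \<in> V \<Longrightarrow> {x, y} \<in> E \<longleftrightarrow> {\<phi> x, \<phi> y} \<in> F"
    using assms(1) unfolding graph_iso_def by blast
  obtain f N where f: "simple_graph W F" "w \<in> W" "finite W" "finite F"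
    "card W \<le> N" "card F < N" "f w = 0"
    "\<And>y. 0 \<le> y \<Longrightarrow> y < int N \<Longrightarrow> \<exists>x\<in>W. f x = y"
    "\<And>d. 1 \<le> d \<Longrightarrow> d < int N \<Longrightarrow> \<exists>x y. {x, y} \<in> F \<and> \<bar>f x - f y\<bar> = d"
    using rooted_gracefulE[OF assms(3)] by metis
  obtain v where v: "v \<in> V" "\<phi> v = w" using bij f(2) unfolding bij_betw_def by blast
  have "inj_on ((`) \<phi>) E"
    using bij assms(2) unfolding bij_betw_def simple_graph_def
    by (meson PowI inj_on_image_Pow inj_on_subset subsetI)
  moreover have "(`) \<phi> ` E \<subseteq> F"
  proof
    fix e assume "e \<in> (`) \<phi> ` E"
    then obtain e' where e': "e' \<in> E" "e = \<phi> ` e'" by blast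
    obtain x y where "e' = {x, y}" "x \<in> V" "y \<in> V"
      using simple_graph_edgeE[OF assms(2) e'(1)] by metis
    then show "e \<in> F" using \<phi> e' by auto
  qed
  ultimately have card: "card E \<le> card F" using f(4) card_inj_on_le by blast
  have "rooted_graceful V E v"
  proof (rule rooted_gracefulI[where f = "f \<circ> \<phi>" and N = N])
    show "card V \<le> N" using bij f(5) by (simp add: bij_betw_same_card)
    show "\<exists>x\<in>V. (f \<circ> \<phi>) x = y" if "0 \<le> y" "y < int N" for y
      using f(8)[OF that] bij unfolding bij_betw_def by auto
    show "\<exists>x y. {x, y} \<in> E \<and> \<bar>(f \<circ> \<phi>) x - (f \<circ> \<phi>) y\<bar> = d" if d: "1 \<le> d" "d < int N" for d
    proof -
      obtain x y where xy: "{x, y} \<in> F" "\<bar>f x - f y\<bar> = d" using f(9) d by blast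
      then have "x \<in> W" "y \<in> W" using simple_graphD[OF f(1)] by blast+
      then obtain x' y' where "x' \<in> V" "y' \<in> V" "x = \<phi> x'" "y = \<phi> y'"
        using bij unfolding bij_betw_def by blast
      then show ?thesis using xy \<phi> by (intro exI[of _ x'] exI[of _ y']) auto
    qed
  qed (use assms(2) v f(6,7) card in auto)
  then show ?thesis by blast
qed

lemma rooted_graceful_imp_graceful:
  assumes "rooted_graceful V E v"
  shows "graceful V E"
proof -
  obtain f N where f: "simple_graph V E" "v \<in> V" "finite V" "finite E"
    "card V \<le> N" "card E < N" "f v = 0"
    "\<And>y. 0 \<le> y \<Longrightarrow> y < int N \<Longrightarrow> \<exists>x\<in>V. f x = y"
    "\<And>d. 1 \<le> d \<Longrightarrow> d < int N \<Longrightarrow> \<exists>x y. {x, y} \<in> E \<and> \<bar>f x - f y\<bar> = d"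
    using rooted_gracefulE[OF assms] by metis
  have sub: "{0..<int N} \<subseteq> f ` V" using f(8) by fastforce
  then have "N \<le> card (f ` V)"
    using card_mono[of "f ` V" "{0..<int N}"] f(3) by simp
  then have cards: "card (f ` V) = card V" "card (f ` V) = N"
    using f(5) card_image_le[OF f(3), of f] by auto
  have inj: "inj_on f V" using cards(1) f(3) by (simp add: eq_card_imp_inj_on)
  have image: "f ` V = {0..<int N}"
    using card_subset_eq[OF _ sub] f(3) cards by simp
  \<comment> \<open>One edge is chosen for each label. An edge determines its label, so the N - 1
    chosen edges are distinct and, as \<open>E\<close> has fewer than N edges, they exhaust
    \<open>E\<close>.\<close>
  obtain p where p: "\<And>d. d \<in> {1..<int N} \<Longrightarrow> {fst (p d), snd (p d)} \<in> E \<and> \<bar>f (fst (p d)) - f (snd (p d))\<bar> = d"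
  proof -
    have "\<exists>z. {fst z, snd z} \<in> E \<and> \<bar>f (fst z) - f (snd z)\<bar> = d" if "d \<in> {1..<int N}" for d
      using f(9)[of d] that by auto
    then show ?thesis using that by metis
  qed
  define e where "e d = {fst (p d), snd (p d)}" for d
  have label: "\<bar>f x - f y\<bar> = d" if "d \<in> {1..<int N}" "{x, y} = e d" for x y d
    using p[OF that(1)] that(2) unfolding e_def doubleton_eq_iff by auto
  have "inj_on e {1..<int N}"
    using p label unfolding inj_on_def by (metis e_def)
  then have "card (e ` {1..<int N}) = N - 1" by (simp add: card_image)
  moreover have esub: "e ` {1..<int N} \<subseteq> E" using p unfolding e_def by blast
  ultimately have eE: "e ` {1..<int N} = E" and cardE: "card E = N - 1"
    using card_mono[OF f(4) esub] f(6) card_subset_eq[OF f(4) esub] by auto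
  have "{u, v} = {x, y}" if uv: "{u, v} \<in> E" and xy: "{x, y} \<in> E"
    and eq: "\<bar>f u - f v\<bar> = \<bar>f x - f y\<bar>" for u v x y
  proof -
    obtain d d' where d: "d \<in> {1..<int N}" "{u, v} = e d" "d' \<in> {1..<int N}" "{x, y} = e d'"
      using uv xy eE by (metis imageE)
    then show ?thesis using label eq by metis
  qed
  moreover have "f ` V \<subseteq> {0..int (card E)}" using image cardE f(6) by auto
  ultimately show ?thesis unfolding graceful_def using inj by blast
qed

section \<open>Reduced lobes\<close>

definition branches :: "(nat \<Rightarrow> nat) \<Rightarrow> (nat \<Rightarrow> nat \<Rightarrow> nat) \<Rightarrow> nat \<Rightarrow> nat set" where
  "branches s k i = {j. 1 \<le> j \<and> j \<le> s i \<and> k i j \<noteq> 0}"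

lemma finite_branches [simp]: "finite (branches s k i)"
  by (rule finite_subset[of _ "{..s i}"]) (auto simp: branches_def)

lemma reduced_lobe_verts_eq:
  "reduced_lobe_verts s k i =
     insert (Sp i) (Br i ` branches s k i \<union> (\<Union>j\<in>branches s k i. Lf i j ` {1..k i j}))"
  unfolding reduced_lobe_verts_def branches_def by auto

lemma reduced_lobe_edges_eq:
  "reduced_lobe_edges s k i =
     (\<lambda>j. {Sp i, Br i j}) ` branches s k i
     \<union> (\<Union>j\<in>branches s k i. (\<lambda>l. {Br i j, Lf i j l}) ` {1..k i j})"
  unfolding reduced_lobe_edges_def branches_def
  by (intro arg_cong2[where f = "(\<union>)"]; fastforce)

lemma simple_graph_reduced_lobe:
  "simple_graph (reduced_lobe_verts s k i) (reduced_lobe_edges s k i)"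
  unfolding simple_graph_def reduced_lobe_verts_eq reduced_lobe_edges_eq by auto

text \<open>The 2h + 1 branch vertices receive m, ..., m - h and 1, ..., h, which leaves the
  interval \<open>X\<close> to the leaves. As the large labels outnumber the small ones by one,
  \<open>X\<close> is invariant under x -> m - x; this is where oddness enters. Hence attaching all
  leaves to m produces exactly the edge labels in \<open>X\<close>, and the edges at the centre,
  labelled 0, produce the others.\<close>

lemma rooted_graceful_reduced_lobe:
  assumes "odd (card (branches s k i))"
  shows "rooted_graceful (reduced_lobe_verts s k i) (reduced_lobe_edges s k i) (Sp i)"
proof -
  define B where "B = branches s k i"
  have finB: "finite B" and posB: "\<And>j. j \<in> B \<Longrightarrow> 0 < k i j"
    by (simp add: B_def) (simp add: B_def branches_def)
  define os where "os = filter (\<lambda>j. odd (k i j)) (sorted_list_of_set B)"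
  define es where "es = filter (\<lambda>j. even (k i j)) (sorted_list_of_set B)"
  define js where "js = os @ es"
  have js: "distinct js" "set js = B"
    using finB by (auto simp: js_def os_def es_def)
  obtain h where h: "card B = 2 * h + 1" using assms B_def by (auto elim: oddE)
  then have len: "length js = 2 * h + 1" using js by (metis distinct_card)
  define m where "m = 2 * h + 1 + sum (k i) B"
  \<comment> \<open>\<open>m\<close> is the number of edges, so \<open>X\<close> has one label per
    leaf. The end points of \<open>X\<close> add up to m + 1, the sum of the first two centres m and
    1.\<close>
  define X where "X = {int h + 1..<int m - int h}"
  have finX: "finite X" by (simp add: X_def)
  have "sum_list (map (k i) js) = sum (k i) B"
    using js by (simp add: sum_list_distinct_conv_sum_set)
  then have "distributes (int m) 1 (map (k i) os @ map (k i) es) X"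
    unfolding X_def using posB finB
    by (intro distributes_interval) (auto simp: os_def es_def js_def m_def)
  then have "distributes (int m) 1 (map (k i) js) X" by (simp add: js_def)
  then obtain g where g: "\<forall>x\<in>X. g x < length (map (k i) js)"
      "\<forall>t<length (map (k i) js). card {x\<in>X. g x = t} = map (k i) js ! t"
      "(\<lambda>x. transfer_label (int m) 1 (g x) x) ` X = (\<lambda>x. int m - x) ` X"
    unfolding distributes_def by (elim exE conjE) (rule that)
  \<comment> \<open>\<open>g\<close> sends a leaf label to the position of its branch; conversely,
    \<open>b t\<close> distributes the labels in the fibre over t among the leaves of the t-th
    branch.\<close>
  have "\<exists>b. bij_betw b {1..k i (js ! t)} {x\<in>X. g x = t}" if "t < length js" for t
    using g(2) that finX by (intro finite_same_card_bij) auto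
  then obtain b where b: "\<And>t. t < length js \<Longrightarrow> bij_betw (b t) {1..k i (js ! t)} {x\<in>X. g x = t}"
    by metis
  define pos where "pos = inv_into {..<length js} ((!) js)"
  have pos: "pos (js ! t) = t" if "t < length js" for t
    using that js(1) unfolding pos_def by (intro inv_into_f_f inj_on_nth) auto
  \<comment> \<open>These are the transfer centres for W = m and W' = 1.\<close>
  define w where "w t = (if even t then int m - int (t div 2) else 1 + int (t div 2))" for t
  define f where "f v = (case v of Sp _ \<Rightarrow> 0 | Br _ j \<Rightarrow> w (pos j) | Lf _ j l \<Rightarrow> b (pos j) l)" for v
  have f_Br: "f (Br i (js ! t)) = w t" if "t < length js" for t
    using that by (simp add: f_def pos)
  have leaf: "\<exists>l\<in>{1..k i (js ! g x)}. f (Lf i (js ! g x) l) = x" if "x \<in> X" for x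
  proof -
    have t: "g x < length js" using g(1) that by simp
    have "x \<in> b (g x) ` {1..k i (js ! g x)}"
      using b[OF t] that unfolding bij_betw_def by blast
    moreover have "f (Lf i (js ! g x) l) = b (g x) l" for l using t by (simp add: f_def pos)
    ultimately show ?thesis by (metis imageE)
  qed
  have js_B: "js ! t \<in> B" if "t < length js" for t using that js(2) nth_mem by blast
  \<comment> \<open>A label outside \<open>X\<close> is at most h, and then occurs at an odd
    position, or at least m - h, and then occurs at an even one.\<close>
  have spoke: "\<exists>j\<in>B. f (Br i j) = y" if "1 \<le> y" "y \<le> int m" "y \<notin> X" for y
  proof (cases "y \<le> int h")
    case True
    define t where "t = 2 * (nat y - 1) + 1"
    have "t < length js" using True that len by (auto simp: t_def)
    moreover have "w t = y" using that by (simp add: w_def t_def)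
    ultimately show ?thesis using js_B f_Br by blast
  next
    case False
    define t where "t = 2 * nat (int m - y)"
    have "t < length js" using False that len by (auto simp: t_def X_def)
    moreover have "w t = y" using that by (simp add: w_def t_def)
    ultimately show ?thesis using js_B f_Br by blast
  qed
  show ?thesis
  proof (rule rooted_gracefulI[where f = f and N = "Suc m"])
    show "simple_graph (reduced_lobe_verts s k i) (reduced_lobe_edges s k i)"
      by (rule simple_graph_reduced_lobe)
    show "Sp i \<in> reduced_lobe_verts s k i" by (simp add: reduced_lobe_verts_eq)
    have "card (\<Union>j\<in>B. Lf i j ` {1..k i j}) \<le> (\<Sum>j\<in>B. card (Lf i j ` {1..k i j}))"
      using finB by (rule card_UN_le)
    also have "\<dots> \<le> (\<Sum>j\<in>B. k i j)"
      by (rule sum_mono) (metis card_atLeastAtMost card_image_le diff_Suc_1 finite_atLeastAtMost)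
    finally have "card (\<Union>j\<in>B. Lf i j ` {1..k i j}) \<le> (\<Sum>j\<in>B. k i j)" .
    moreover have "card (Br i ` B) \<le> card B" using finB by (rule card_image_le)
    moreover have "card (reduced_lobe_verts s k i)
        \<le> Suc (card (Br i ` B) + card (\<Union>j\<in>B. Lf i j ` {1..k i j}))"
      unfolding reduced_lobe_verts_eq B_def[symmetric]
      by (rule card_insert_le_m1) (simp_all add: card_Un_le)
    ultimately show "card (reduced_lobe_verts s k i) \<le> Suc m" using h m_def by linarith
    have "card (\<Union>j\<in>B. (\<lambda>l. {Br i j, Lf i j l}) ` {1..k i j})
        \<le> (\<Sum>j\<in>B. card ((\<lambda>l. {Br i j, Lf i j l}) ` {1..k i j}))"
      using finB by (rule card_UN_le)
    also have "\<dots> \<le> (\<Sum>j\<in>B. k i j)"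
      by (rule sum_mono) (metis card_atLeastAtMost card_image_le diff_Suc_1 finite_atLeastAtMost)
    finally have "card (\<Union>j\<in>B. (\<lambda>l. {Br i j, Lf i j l}) ` {1..k i j}) \<le> (\<Sum>j\<in>B. k i j)" .
    moreover have "card ((\<lambda>j. {Sp i, Br i j}) ` B) \<le> card B" using finB by (rule card_image_le)
    moreover have "card (reduced_lobe_edges s k i)
        \<le> card ((\<lambda>j. {Sp i, Br i j}) ` B) + card (\<Union>j\<in>B. (\<lambda>l. {Br i j, Lf i j l}) ` {1..k i j})"
      unfolding reduced_lobe_edges_eq B_def[symmetric] by (rule card_Un_le)
    ultimately show "card (reduced_lobe_edges s k i) < Suc m" using h m_def by linarith
    show "f (Sp i) = 0" by (simp add: f_def)
    show "\<exists>x\<in>reduced_lobe_verts s k i. f x = y" if y: "0 \<le> y" "y < int (Suc m)" for y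
    proof -
      consider "y = 0" | "y \<in> X" | "1 \<le> y" "y \<le> int m" "y \<notin> X" using y by force
      then show ?thesis
      proof cases
        case 1
        then show ?thesis by (auto simp: reduced_lobe_verts_eq f_def)
      next
        case 2
        then have "js ! g y \<in> B" using g(1) js_B by simp
        then show ?thesis using leaf[OF 2] unfolding reduced_lobe_verts_eq B_def by blast
      next
        case 3
        then show ?thesis using spoke[OF 3] unfolding reduced_lobe_verts_eq B_def by blast
      qed
    qed
    show "\<exists>x y. {x, y} \<in> reduced_lobe_edges s k i \<and> \<bar>f x - f y\<bar> = d"
      if d: "1 \<le> d" "d < int (Suc m)" for d
    proof (cases "d \<in> X")
      case True
      \<comment> \<open>By the invariance of \<open>X\<close>, d is an edge label when all leaves
        hang on m, hence also after the transfers.\<close>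
      then have "int m - d \<in> X" by (auto simp: X_def)
      then have "d \<in> (\<lambda>x. int m - x) ` X" by (intro image_eqI[of _ _ "int m - d"]) auto
      then obtain x where x: "x \<in> X" "transfer_label (int m) 1 (g x) x = d"
        unfolding g(3)[symmetric] by auto
      have t: "g x < length js" using g(1) x(1) by simp
      obtain l where l: "l \<in> {1..k i (js ! g x)}" "f (Lf i (js ! g x) l) = x" using leaf[OF x(1)] by blast
      have "\<bar>w (g x) - x\<bar> = d"
        using x(2) d unfolding w_def transfer_label_def by (auto split: if_splits)
      then have "\<bar>f (Br i (js ! g x)) - f (Lf i (js ! g x) l)\<bar> = d" using l(2) f_Br[OF t] by simp
      moreover have "{Br i (js ! g x), Lf i (js ! g x) l} \<in> reduced_lobe_edges s k i"
        using js_B[OF t] l(1) unfolding reduced_lobe_edges_eq B_def by blast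
      ultimately show ?thesis by blast
    next
      case False
      then obtain j where "j \<in> B" "f (Br i j) = d" using spoke[of d] d by auto
      then have "\<bar>f (Sp i) - f (Br i j)\<bar> = d" "{Sp i, Br i j} \<in> reduced_lobe_edges s k i"
        using d unfolding reduced_lobe_edges_eq B_def by (auto simp: f_def)
      then show ?thesis by blast
    qed
  qed
qed

section \<open>Recovering the branch sizes of a lobe from vertex degrees\<close>

lemma graph_iso_card_degree:
  assumes "graph_iso V E W F" "simple_graph V E" "simple_graph W F"
  shows "card {x\<in>V. P (degree E x)} = card {y\<in>W. P (degree F y)}"
proof -
  obtain \<phi> where bij: "bij_betw \<phi> V W"
    and \<phi>: "\<And>x y. x \<in> V \<Longrightarrow> y \<in> V \<Longrightarrow> {x, y} \<in> E \<longleftrightarrow> {\<phi> x, \<phi> y} \<in> F"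
    using assms(1) unfolding graph_iso_def by blast
  have inj: "inj_on \<phi> V" and im: "\<phi> ` V = W" using bij by (auto simp: bij_betw_def)
  have deg: "degree F (\<phi> x) = degree E x" if x: "x \<in> V" for x
  proof -
    have eq: "(`) \<phi> ` {e\<in>E. x \<in> e} = {e\<in>F. \<phi> x \<in> e}"
    proof (intro equalityI subsetI)
      fix e assume "e \<in> (`) \<phi> ` {e\<in>E. x \<in> e}"
      then obtain e' where e': "e' \<in> E" "x \<in> e'" "e = \<phi> ` e'" by blast
      obtain y z where "e' = {y, z}" "y \<in> V" "z \<in> V"
        using simple_graph_edgeE[OF assms(2) e'(1)] by metis
      then show "e \<in> {e\<in>F. \<phi> x \<in> e}" using \<phi> e' by auto
    next
      fix e assume "e \<in> {e\<in>F. \<phi> x \<in> e}"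
      then have e: "e \<in> F" "\<phi> x \<in> e" by auto
      obtain y z where yz: "e = {y, z}" "y \<in> W" "z \<in> W"
        using simple_graph_edgeE[OF assms(3) e(1)] by metis
      then obtain y' z' where *: "y' \<in> V" "z' \<in> V" "y = \<phi> y'" "z = \<phi> z'" using im by blast
      then have "{y', z'} \<in> E" using \<phi> e(1) yz by blast
      moreover have "x \<in> {y', z'}" using e(2) yz * inj x by (auto dest: inj_onD)
      ultimately show "e \<in> (`) \<phi> ` {e\<in>E. x \<in> e}"
        using * yz by (intro image_eqI[of _ _ "{y', z'}"]) auto
    qed
    have "inj_on ((`) \<phi>) {e\<in>E. x \<in> e}"
      by (rule inj_on_subset[OF inj_on_image_Pow[OF inj]]) (use assms(2) in \<open>auto simp: simple_graph_def\<close>)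
    from card_image[OF this] show ?thesis unfolding eq degree_def .
  qed
  have eq: "\<phi> ` {x\<in>V. P (degree E x)} = {y\<in>W. P (degree F y)}"
    unfolding im[symmetric] using deg by auto
  have "inj_on \<phi> {x\<in>V. P (degree E x)}" using inj by (rule inj_on_subset) auto
  from card_image[OF this] show ?thesis unfolding eq by simp
qed

lemma degree_reduced_lobe_Sp: "degree (reduced_lobe_edges s k i) (Sp i) = card (branches s k i)"
proof -
  have "{e \<in> reduced_lobe_edges s k i. Sp i \<in> e} = (\<lambda>j. {Sp i, Br i j}) ` branches s k i"
    unfolding reduced_lobe_edges_eq by auto
  moreover have "inj_on (\<lambda>j. {Sp i, Br i j}) (branches s k i)"
    by (auto simp: inj_on_def doubleton_eq_iff)
  ultimately show ?thesis unfolding degree_def by (simp add: card_image)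
qed

lemma degree_reduced_lobe_Br:
  assumes "j \<in> branches s k i"
  shows "degree (reduced_lobe_edges s k i) (Br i j) = Suc (k i j)"
proof -
  have "{e \<in> reduced_lobe_edges s k i. Br i j \<in> e}
      = insert {Sp i, Br i j} ((\<lambda>l. {Br i j, Lf i j l}) ` {1..k i j})"
    using assms unfolding reduced_lobe_edges_eq by auto
  moreover have "inj_on (\<lambda>l. {Br i j, Lf i j l}) {1..k i j}"
    by (auto simp: inj_on_def doubleton_eq_iff)
  moreover have "{Sp i, Br i j} \<notin> (\<lambda>l. {Br i j, Lf i j l}) ` {1..k i j}"
    by (auto simp: doubleton_eq_iff)
  ultimately show ?thesis unfolding degree_def by (simp add: card_image)
qed

lemma degree_reduced_lobe_Lf:
  assumes "j \<in> branches s k i" "l \<in> {1..k i j}"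
  shows "degree (reduced_lobe_edges s k i) (Lf i j l) = 1"
proof -
  have "{Br i j, Lf i j l} \<in> reduced_lobe_edges s k i"
    using assms unfolding reduced_lobe_edges_eq by blast
  moreover have "e = {Br i j, Lf i j l}" if "e \<in> reduced_lobe_edges s k i" "Lf i j l \<in> e" for e
    using that unfolding reduced_lobe_edges_eq by auto
  ultimately have "{e \<in> reduced_lobe_edges s k i. Lf i j l \<in> e} = {{Br i j, Lf i j l}}"
    by blast
  then show ?thesis unfolding degree_def by simp
qed

text \<open>Excluding degree 1 removes all leaves from the count. What remains is the centre, whose
  degree is the number of branches, and the branch vertices.\<close>

lemma card_degree_reduced_lobe:
  assumes "\<not> P 1"
  shows "card {x \<in> reduced_lobe_verts s k i. P (degree (reduced_lobe_edges s k i) x)}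
    = of_bool (P (card (branches s k i))) + card {j \<in> branches s k i. P (Suc (k i j))}"
proof -
  let ?S = "if P (card (branches s k i)) then {Sp i} else {}"
  have "{x \<in> reduced_lobe_verts s k i. P (degree (reduced_lobe_edges s k i) x)}
      = ?S \<union> Br i ` {j \<in> branches s k i. P (Suc (k i j))}"
    using assms degree_reduced_lobe_Lf[of _ s k i]
    unfolding reduced_lobe_verts_eq
    by (auto simp: degree_reduced_lobe_Sp degree_reduced_lobe_Br)
  moreover have "card (?S \<union> Br i ` {j \<in> branches s k i. P (Suc (k i j))})
      = card ?S + card (Br i ` {j \<in> branches s k i. P (Suc (k i j))})"
    by (rule card_Un_disjoint) auto
  moreover have "card (Br i ` {j \<in> branches s k i. P (Suc (k i j))})
      = card {j \<in> branches s k i. P (Suc (k i j))}"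
    by (rule card_image) (auto simp: inj_on_def)
  ultimately show ?thesis by simp
qed

text \<open>
  A lobe with a single branch is a star, so an isomorphism need not map centre to centre. Counting
  vertices of each degree at least 2 avoids this: it determines the number of branches because
  both numbers are odd, and then the branch sizes.
\<close>

lemma reduced_lobe_iso_branches:
  assumes iso: "graph_iso (reduced_lobe_verts s k i) (reduced_lobe_edges s k i)
                     (reduced_lobe_verts s k i') (reduced_lobe_edges s k i')"
    and odd: "odd (card (branches s k i))" "odd (card (branches s k i'))"
  obtains \<beta> where "bij_betw \<beta> (branches s k i) (branches s k i')"
    "\<And>j. j \<in> branches s k i \<Longrightarrow> k i' (\<beta> j) = k i j"
proof -
  have count: "of_bool (P (card (branches s k i))) + card {j \<in> branches s k i. P (Suc (k i j))}
      = of_bool (P (card (branches s k i'))) + card {j \<in> branches s k i'. P (Suc (k i' j))}"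
    if "\<not> P 1" for P :: "nat \<Rightarrow> bool"
    using graph_iso_card_degree[OF iso simple_graph_reduced_lobe simple_graph_reduced_lobe, of P]
      card_degree_reduced_lobe[of P s k] that by simp
  have "{j \<in> branches s k a. 2 \<le> Suc (k a j)} = branches s k a" for a
    by (auto simp: branches_def)
  then have "of_bool (2 \<le> card (branches s k i)) + card (branches s k i)
      = of_bool (2 \<le> card (branches s k i')) + card (branches s k i')"
    using count[of "\<lambda>n. 2 \<le> n"] by simp
  \<comment> \<open>The contributions of the two centres differ by at most one, whereas two odd
    numbers never differ by exactly one.\<close>
  then have card: "card (branches s k i) = card (branches s k i')"
    using odd by (auto simp: of_bool_def split: if_splits)
  have "card {j \<in> branches s k i. k i j = n} = card {j \<in> branches s k i'. k i' j = n}" for n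
  proof (cases "n = 0")
    case True
    then have "{j \<in> branches s k a. k a j = n} = {}" for a by (auto simp: branches_def)
    then show ?thesis by (simp only:)
  next
    case False
    \<comment> \<open>The centres now have equal degrees, so their contributions cancel; n > 0 keeps
      degree 1 out of the count.\<close>
    then show ?thesis using count[of "\<lambda>d. d = Suc n"] card by simp
  qed
  then have "\<exists>b. bij_betw b {j \<in> branches s k i. k i j = n} {j \<in> branches s k i'. k i' j = n}" for n
    by (intro finite_same_card_bij) auto
  then obtain b where b: "\<And>n. bij_betw (b n) {j \<in> branches s k i. k i j = n} {j \<in> branches s k i'. k i' j = n}"
    using choice[of "\<lambda>n b. bij_betw b {j \<in> branches s k i. k i j = n} {j \<in> branches s k i'. k i' j = n}"]
    by blast
  \<comment> \<open>The bijections between branches of equal size are glued together.\<close>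
  define \<beta> where "\<beta> j = b (k i j) j" for j
  have \<beta>: "\<beta> j \<in> branches s k i' \<and> k i' (\<beta> j) = k i j" if "j \<in> branches s k i" for j
    using b[of "k i j"] that unfolding bij_betw_def \<beta>_def by blast
  have "inj_on \<beta> (branches s k i)"
  proof (rule inj_onI)
    fix x y assume xy: "x \<in> branches s k i" "y \<in> branches s k i" "\<beta> x = \<beta> y"
    then have "k i x = k i y" using \<beta> by metis
    moreover have "inj_on (b (k i x)) {j \<in> branches s k i. k i j = k i x}"
      using b by (simp add: bij_betw_def)
    ultimately show "x = y" using xy by (auto simp: \<beta>_def dest: inj_onD)
  qed
  moreover have "\<beta> ` branches s k i \<subseteq> branches s k i'" using \<beta> by blast
  ultimately have "bij_betw \<beta> (branches s k i) (branches s k i')"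
    using card by (simp add: bij_betw_def card_image card_subset_eq)
  then show thesis using that \<beta> by blast
qed

text \<open>Unlike the isomorphism provided by pairwise similarity, this map always takes centre to
  centre, as wrapping two lobes around the rest requires.\<close>

definition lobe_copy :: "nat \<Rightarrow> (nat \<Rightarrow> nat) \<Rightarrow> lob_vertex \<Rightarrow> lob_vertex" where
  "lobe_copy i \<beta> v = (case v of Sp _ \<Rightarrow> Sp i | Br _ j \<Rightarrow> Br i (\<beta> j) | Lf _ j l \<Rightarrow> Lf i (\<beta> j) l)"

lemma lobe_copy:
  assumes "bij_betw \<beta> (branches s k i) (branches s k i')"
    and k: "\<And>j. j \<in> branches s k i \<Longrightarrow> k i' (\<beta> j) = k i j"
  shows "lobe_copy i' \<beta> ` reduced_lobe_verts s k i = reduced_lobe_verts s k i'"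
    and "(`) (lobe_copy i' \<beta>) ` reduced_lobe_edges s k i = reduced_lobe_edges s k i'"
    and "inj_on (lobe_copy i' \<beta>) (reduced_lobe_verts s k i)"
proof -
  have im: "branches s k i' = \<beta> ` branches s k i" and inj: "inj_on \<beta> (branches s k i)"
    using assms(1) by (auto simp: bij_betw_def)
  show "lobe_copy i' \<beta> ` reduced_lobe_verts s k i = reduced_lobe_verts s k i'"
    unfolding reduced_lobe_verts_eq im by (simp add: image_Un image_UN image_image lobe_copy_def k)
  show "(`) (lobe_copy i' \<beta>) ` reduced_lobe_edges s k i = reduced_lobe_edges s k i'"
    unfolding reduced_lobe_edges_eq im by (simp add: image_Un image_UN image_image lobe_copy_def k)
  show "inj_on (lobe_copy i' \<beta>) (reduced_lobe_verts s k i)"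
    using inj unfolding reduced_lobe_verts_eq by (auto simp: inj_on_def lobe_copy_def)
qed

section \<open>Lobsters\<close>

definition pendants :: "(nat \<Rightarrow> nat) \<Rightarrow> (nat \<Rightarrow> nat \<Rightarrow> nat) \<Rightarrow> nat \<Rightarrow> lob_vertex set" where
  "pendants s k i = Br i ` {j. 1 \<le> j \<and> j \<le> s i \<and> k i j = 0}"

text \<open>Pendant vertices are kept apart from the reduced lobes because only the latter match in
  pairs; pendants are attached once their spinal vertex is a root.\<close>

definition tail_verts :: "nat \<Rightarrow> (nat \<Rightarrow> nat) \<Rightarrow> (nat \<Rightarrow> nat \<Rightarrow> nat) \<Rightarrow> nat \<Rightarrow> lob_vertex set" where
  "tail_verts r s k i = (\<Union>a\<in>{i..r}. reduced_lobe_verts s k a \<union> pendants s k a)"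

definition tail_edges :: "nat \<Rightarrow> (nat \<Rightarrow> nat) \<Rightarrow> (nat \<Rightarrow> nat \<Rightarrow> nat) \<Rightarrow> nat \<Rightarrow> lob_vertex set set" where
  "tail_edges r s k i =
     (\<Union>a\<in>{i..r}. reduced_lobe_edges s k a \<union> (\<lambda>p. {Sp a, p}) ` pendants s k a)
     \<union> (\<lambda>a. {Sp a, Sp (Suc a)}) ` {i..<r}"

lemma finite_pendants [simp]: "finite (pendants s k i)"
  by (rule finite_subset[of _ "Br i ` {..s i}"]) (auto simp: pendants_def)

text \<open>Different lobes, and a lobe and a later tail, are told apart by comparing this
  index.\<close>

fun spine_index :: "lob_vertex \<Rightarrow> nat" where
  "spine_index (Sp i) = i"
| "spine_index (Br i j) = i"
| "spine_index (Lf i j l) = i"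

lemma spine_index_reduced_lobe: "x \<in> reduced_lobe_verts s k i \<Longrightarrow> spine_index x = i"
  unfolding reduced_lobe_verts_eq by auto

lemma spine_index_pendants: "x \<in> pendants s k i \<Longrightarrow> spine_index x = i"
  unfolding pendants_def by auto

lemma spine_index_tail: "x \<in> tail_verts r s k i \<Longrightarrow> i \<le> spine_index x"
  unfolding tail_verts_def using spine_index_reduced_lobe spine_index_pendants by fastforce

lemma pendants_disjoint: "pendants s k i \<inter> reduced_lobe_verts s k i = {}"
  unfolding pendants_def reduced_lobe_verts_eq branches_def by auto

text \<open>The induction removes two spinal vertices at a time. The reduced lobes at v_i and
  v_(i+1) wrap around a tree rooted at v_(i+1) that consists of this vertex, its pendants and the
  tail from i + 2; the pendants at v_i are added last. For odd r the last lobe stands alone.\<close>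

lemma rooted_graceful_tail:
  assumes sim: "pairwise_similar r s k"
    and eo: "\<forall>i. 1 \<le> i \<and> i \<le> r \<longrightarrow> essentially_odd s k i"
    and "odd i" "i \<le> r"
  shows "rooted_graceful (tail_verts r s k i) (tail_edges r s k i) (Sp i)"
  using assms(3,4)
proof (induction "r - i" arbitrary: i rule: less_induct)
  case less
  have odd_branches: "odd (card (branches s k a))" if "1 \<le> a" "a \<le> r" for a
    using eo that unfolding essentially_odd_def degree_reduced_lobe_Sp by blast
  have i: "1 \<le> i" using less.prems(1) by (auto elim: oddE)
  have lobe: "rooted_graceful (reduced_lobe_verts s k i) (reduced_lobe_edges s k i) (Sp i)"
    using odd_branches i less.prems(2) by (intro rooted_graceful_reduced_lobe) auto
  show ?case
  proof (cases "i = r")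
    case True
    then show ?thesis
      using rooted_graceful_pendants[OF lobe finite_pendants pendants_disjoint]
      by (simp add: tail_verts_def tail_edges_def)
  next
    case False
    then have ir: "i < r" using less.prems(2) by simp
    let ?i = "Suc i" and ?j = "Suc (Suc i)"
    \<comment> \<open>If r = i + 1, nothing follows v_(i+1): this edge is absent, and the inner tree
      starts as a single vertex.\<close>
    define L where "L = (if ?j \<le> r then {{Sp ?i, Sp ?j}} else {})"
    have "rooted_graceful (insert (Sp ?i) (tail_verts r s k ?j)) (tail_edges r s k ?j \<union> L) (Sp ?i)"
    proof (cases "?j \<le> r")
      case True
      then have "rooted_graceful (tail_verts r s k ?j) (tail_edges r s k ?j) (Sp ?j)"
        using less.prems by (intro less.hyps) auto
      moreover have "Sp ?i \<notin> tail_verts r s k ?j" using spine_index_tail[of "Sp ?i"] by fastforce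
      ultimately show ?thesis using rooted_graceful_new_root True by (fastforce simp: L_def)
    next
      case False
      then show ?thesis
        by (simp add: L_def tail_verts_def tail_edges_def rooted_graceful_single)
    qed
    moreover have "pendants s k ?i \<inter> insert (Sp ?i) (tail_verts r s k ?j) = {}"
      using spine_index_tail spine_index_pendants by (fastforce simp: pendants_def)
    ultimately have Q: "rooted_graceful (insert (Sp ?i) (tail_verts r s k ?j) \<union> pendants s k ?i)
        (tail_edges r s k ?j \<union> L \<union> (\<lambda>p. {Sp ?i, p}) ` pendants s k ?i) (Sp ?i)"
      (is "rooted_graceful ?Q ?E _")
      by (intro rooted_graceful_pendants) auto
    have Q_index: "spine_index x \<noteq> i" if "x \<in> ?Q" for x
    proof -
      from that consider "x = Sp ?i" | "x \<in> tail_verts r s k ?j" | "x \<in> pendants s k ?i" by blast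
      then have "i < spine_index x"
        by cases (auto dest: spine_index_tail spine_index_pendants)
      then show ?thesis by simp
    qed
    have "graph_iso (reduced_lobe_verts s k i) (reduced_lobe_edges s k i)
        (reduced_lobe_verts s k ?i) (reduced_lobe_edges s k ?i)"
      using sim less.prems(1) i ir unfolding pairwise_similar_def by auto
    then obtain \<beta> where \<beta>: "bij_betw \<beta> (branches s k i) (branches s k ?i)"
        "\<And>j. j \<in> branches s k i \<Longrightarrow> k ?i (\<beta> j) = k i j"
      using reduced_lobe_iso_branches odd_branches[of i] odd_branches[of ?i] i ir by (metis Suc_leI le_SucI less_imp_le)
    have copy: "lobe_copy ?i \<beta> ` reduced_lobe_verts s k i = reduced_lobe_verts s k ?i"
      "(`) (lobe_copy ?i \<beta>) ` reduced_lobe_edges s k i = reduced_lobe_edges s k ?i"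
      "inj_on (lobe_copy ?i \<beta>) (reduced_lobe_verts s k i)"
      using lobe_copy[of \<beta> s k i ?i] \<beta> by auto
    have lobe_index: "spine_index x \<noteq> i" if "x \<in> reduced_lobe_verts s k ?i" for x
      using spine_index_reduced_lobe[OF that] by simp
    \<comment> \<open>In the bipartition of a lobe the centre and the leaves form one class, the
      branch vertices the other.\<close>
    define col where "col v = (case v of Br _ _ \<Rightarrow> False | _ \<Rightarrow> True)" for v
    have "rooted_graceful
        (reduced_lobe_verts s k i \<union> lobe_copy ?i \<beta> ` reduced_lobe_verts s k i \<union> ?Q)
        (reduced_lobe_edges s k i \<union> (`) (lobe_copy ?i \<beta>) ` reduced_lobe_edges s k i
          \<union> ?E \<union> {{Sp i, Sp ?i}}) (Sp i)"
    proof (rule rooted_graceful_double[OF lobe Q, where col = col and \<phi> = "lobe_copy ?i \<beta>"])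
      show "col x \<longleftrightarrow> \<not> col y" if "{x, y} \<in> reduced_lobe_edges s k i" for x y
      proof -
        from that consider j where "{x, y} = {Sp i, Br i j}" | j l where "{x, y} = {Br i j, Lf i j l}"
          unfolding reduced_lobe_edges_eq by blast
        then show ?thesis by cases (auto simp: doubleton_eq_iff col_def)
      qed
      show "col (Sp i)" by (simp add: col_def)
      show "inj_on (lobe_copy ?i \<beta>) (reduced_lobe_verts s k i)" by (rule copy(3))
      show "lobe_copy ?i \<beta> (Sp i) = Sp ?i" by (simp add: lobe_copy_def)
      show "reduced_lobe_verts s k i \<inter> lobe_copy ?i \<beta> ` reduced_lobe_verts s k i = {}"
        unfolding copy(1) disjoint_iff using lobe_index spine_index_reduced_lobe[of _ s k i] by metis
      show "reduced_lobe_verts s k i \<inter> ?Q = {}"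
        unfolding disjoint_iff using Q_index spine_index_reduced_lobe[of _ s k i] by metis
      \<comment> \<open>The inner tree contains the pendants at v_(i+1) but none of its branches, so
        only v_(i+1) itself is shared.\<close>
      have "x = Sp ?i" if "x \<in> reduced_lobe_verts s k ?i" "x \<in> ?Q" for x
        using that spine_index_tail[of x r s k ?j] spine_index_reduced_lobe[OF that(1)] pendants_disjoint[of s k ?i]
        by auto
      moreover have "Sp ?i \<in> reduced_lobe_verts s k ?i" by (simp add: reduced_lobe_verts_eq)
      ultimately show "lobe_copy ?i \<beta> ` reduced_lobe_verts s k i \<inter> ?Q = {Sp ?i}"
        unfolding copy(1) by blast
    qed
    then have "rooted_graceful (reduced_lobe_verts s k i \<union> reduced_lobe_verts s k ?i \<union> ?Q)
        (reduced_lobe_edges s k i \<union> reduced_lobe_edges s k ?i \<union> ?E \<union> {{Sp i, Sp ?i}}) (Sp i)"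
      unfolding copy(1,2) .
    moreover have "pendants s k i \<inter> (reduced_lobe_verts s k i \<union> reduced_lobe_verts s k ?i \<union> ?Q) = {}"
      using Q_index lobe_index spine_index_pendants[of _ s k i] pendants_disjoint[of s k i]
      unfolding disjoint_iff Un_iff by metis
    ultimately have "rooted_graceful
        (reduced_lobe_verts s k i \<union> reduced_lobe_verts s k ?i \<union> ?Q \<union> pendants s k i)
        (reduced_lobe_edges s k i \<union> reduced_lobe_edges s k ?i \<union> ?E \<union> {{Sp i, Sp ?i}}
          \<union> (\<lambda>p. {Sp i, p}) ` pendants s k i) (Sp i)"
      by (intro rooted_graceful_pendants) auto
    moreover have "{i..r} = insert i (insert ?i {?j..r})" using ir by auto
    then have "tail_verts r s k i
        = reduced_lobe_verts s k i \<union> reduced_lobe_verts s k ?i \<union> ?Q \<union> pendants s k i"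
      by (auto simp: tail_verts_def reduced_lobe_verts_eq)
    moreover have "tail_edges r s k i
        = reduced_lobe_edges s k i \<union> reduced_lobe_edges s k ?i \<union> ?E \<union> {{Sp i, Sp ?i}}
          \<union> (\<lambda>p. {Sp i, p}) ` pendants s k i"
    proof -
      have "{i..<r} = insert i ((if ?j \<le> r then {?i} else {}) \<union> {?j..<r})" using ir by auto
      then have "(\<lambda>a. {Sp a, Sp (Suc a)}) ` {i..<r}
          = {{Sp i, Sp ?i}} \<union> L \<union> (\<lambda>a. {Sp a, Sp (Suc a)}) ` {?j..<r}"
        by (auto simp: L_def)
      then show ?thesis unfolding tail_edges_def \<open>{i..r} = insert i (insert ?i {?j..r})\<close> by auto
    qed
    ultimately show ?thesis by simp
  qed
qed

section \<open>The lobster as the tail from the first spinal vertex\<close>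

lemma lobster_verts_eq: "lobster_verts r s k = tail_verts r s k 1"
proof (rule set_eqI)
  fix x show "x \<in> lobster_verts r s k \<longleftrightarrow> x \<in> tail_verts r s k 1"
    by (cases x)
      (auto simp: lobster_verts_def tail_verts_def reduced_lobe_verts_def pendants_def)
qed

lemma lobster_edges_eq: "lobster_edges r s k = tail_edges r s k 1"
proof -
  have "{{Sp i, Sp (Suc i)} | i. 1 \<le> i \<and> i < r} = (\<lambda>i. {Sp i, Sp (Suc i)}) ` {1..<r}"
    by auto
  \<comment> \<open>The edges from the spine to the u_ij split according to whether u_ij is a
    pendant.\<close>
  moreover have "{{Sp i, Br i j} | i j. 1 \<le> i \<and> i \<le> r \<and> 1 \<le> j \<and> j \<le> s i}
      = (\<Union>i\<in>{1..r}. (\<lambda>j. {Sp i, Br i j}) ` branches s k i \<union> (\<lambda>p. {Sp i, p}) ` pendants s k i)"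
    (is "?L = ?R")
  proof
    show "?L \<subseteq> ?R"
    proof
      fix e assume "e \<in> ?L"
      then obtain i j where ij: "e = {Sp i, Br i j}" "i \<in> {1..r}" "1 \<le> j" "j \<le> s i" by auto
      then have "j \<in> branches s k i \<or> Br i j \<in> pendants s k i"
        by (auto simp: branches_def pendants_def)
      then show "e \<in> ?R" using ij(1,2) by blast
    qed
    show "?R \<subseteq> ?L" unfolding branches_def pendants_def by fastforce
  qed
  \<comment> \<open>The bounds on l already force \<open>k i j\<close> to be non-zero, so only
    branches occur.\<close>
  moreover have "{{Br i j, Lf i j l} | i j l. 1 \<le> i \<and> i \<le> r \<and> 1 \<le> j \<and> j \<le> s i \<and> 1 \<le> l \<and> l \<le> k i j}
      = (\<Union>i\<in>{1..r}. \<Union>j\<in>branches s k i. (\<lambda>l. {Br i j, Lf i j l}) ` {1..k i j})"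
    (is "?L = ?R")
  proof
    show "?L \<subseteq> ?R"
    proof
      fix e assume "e \<in> ?L"
      then obtain i j l where "e = {Br i j, Lf i j l}" "i \<in> {1..r}" "j \<in> branches s k i" "l \<in> {1..k i j}"
        by (auto simp: branches_def)
      then show "e \<in> ?R" by blast
    qed
    show "?R \<subseteq> ?L" unfolding branches_def by fastforce
  qed
  ultimately show ?thesis
    unfolding lobster_edges_def tail_edges_def reduced_lobe_edges_eq 
    by (simp only: UN_Un_distrib Un_ac)
qed

theorem theorem4p2:
  fixes V :: "'a set" and E :: "'a set set"
    and r :: nat and s :: "nat \<Rightarrow> nat" and k :: "nat \<Rightarrow> nat \<Rightarrow> nat"
  assumes "simple_graph V E"
    and "1 \<le> r"
    and "graph_iso V E (lobster_verts r s k) (lobster_edges r s k)"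
    and "pairwise_similar r s k"
    and "\<forall>i. 1 \<le> i \<and> i \<le> r \<longrightarrow> essentially_odd s k i"
  shows "graceful V E"
proof -
  have "rooted_graceful (lobster_verts r s k) (lobster_edges r s k) (Sp 1)"
    unfolding lobster_verts_eq lobster_edges_eq
    using assms(2,4,5) by (intro rooted_graceful_tail) auto
  then obtain v where "rooted_graceful V E v"
    using rooted_graceful_graph_iso[OF assms(3,1)] by metis
  then show ?thesis by (rule rooted_graceful_imp_graceful)
qed

end
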